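(* There exists a group isomorphism $G\to\tilde{G}$, $\sigma\mapsto\tilde{\sigma}$, such that $\sigma(h_{n})=h_{\tilde{\sigma}(n)}$ for all $\sigma\in G$ and all $n\in\mathbb{I}$.
   Context: $\mathbb{K}$ is an algebraically closed field of characteristic zero. $\mathcal{A}$ is the unital associative $\mathbb{K}$-algebra with generators $x,y,z$ and relations $xy+yx=2z$, $yz+zy=2x$, $zx+xz=2y$. $G$ is the subgroup of $\mathrm{Aut}(\mathcal{A})$ (the group of $\mathbb{K}$-algebra automorphisms of $\mathcal{A}$) consisting of the automorphisms that map the set $\{\pm x,\pm y,\pm z\}$ to itself. $\mathbb{I}=\{0,x,y,z\}$ is a set of four symbols, and $\tilde G$ is the group of all permutations of $\mathbb{I}$. The elements $h_n\in\mathcal{A}$ are $h_0=x+y+z$, $h_x=x-y-z$, $h_y=-x+y-z$, $h_z=-x-y+z$. *)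

theory Defs
  imports
    "HOL-Library.Poly_Mapping"
    "HOL-Computational_Algebra.Polynomial"
    "HOL-Algebra.Bij"
begin

text \<open>The free monoid on a type of letters, written additively so that its monoid algebra is
  the convolution ring on finitely supported functions provided by \<^theory>\<open>HOL-Library.Poly_Mapping\<close>.\<close>

datatype 'g word = Word (letters: "'g list")

instantiation word :: (type) monoid_add
begin

definition zero_word :: "'a word"
  where "0 = Word []"

definition plus_word :: "'a word \<Rightarrow> 'a word \<Rightarrow> 'a word"
  where "u + v = Word (letters u @ letters v)"

instance
  by standard (simp_all add: zero_word_def plus_word_def)

end

datatype gen = GX | GY | GZ

type_synonym 'k free_alg = "gen word \<Rightarrow>\<^sub>0 'k"

definition free_gen :: "gen \<Rightarrow> 'k::field free_alg"
  where "free_gen g = Poly_Mapping.single (Word [g]) 1"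

definition free_scale :: "'k::field \<Rightarrow> 'k free_alg \<Rightarrow> 'k free_alg"
  where "free_scale c p = Poly_Mapping.single 0 c * p"

definition two_sided_ideal :: "'r::ring_1 set \<Rightarrow> bool"
  where "two_sided_ideal I \<longleftrightarrow>
    0 \<in> I \<and> (\<forall>a\<in>I. \<forall>b\<in>I. a + b \<in> I) \<and> (\<forall>a\<in>I. \<forall>r. r * a \<in> I \<and> a * r \<in> I)"

definition ideal_generated :: "'r::ring_1 set \<Rightarrow> 'r set"
  where "ideal_generated S = \<Inter> {I. two_sided_ideal I \<and> S \<subseteq> I}"

definition relators :: "'k::field free_alg set"
  where "relators =
   {free_gen GX * free_gen GY + free_gen GY * free_gen GX - 2 * free_gen GZ,
    free_gen GY * free_gen GZ + free_gen GZ * free_gen GY - 2 * free_gen GX,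
    free_gen GZ * free_gen GX + free_gen GX * free_gen GZ - 2 * free_gen GY}"

definition relation_ideal :: "'k::field free_alg set"
  where "relation_ideal = ideal_generated relators"

lemma two_sided_ideal_ideal_generated: "two_sided_ideal (ideal_generated S)"
  unfolding two_sided_ideal_def ideal_generated_def by blast

lemma relation_ideal_zero: "0 \<in> relation_ideal"
  and relation_ideal_add: "a \<in> relation_ideal \<Longrightarrow> b \<in> relation_ideal \<Longrightarrow> a + b \<in> relation_ideal"
  and relation_ideal_left: "a \<in> relation_ideal \<Longrightarrow> r * a \<in> relation_ideal"
  and relation_ideal_right: "a \<in> relation_ideal \<Longrightarrow> a * r \<in> relation_ideal"
  using two_sided_ideal_ideal_generated[of relators]
  unfolding two_sided_ideal_def relation_ideal_def by blast+

lemma relation_ideal_minus: "a \<in> relation_ideal \<Longrightarrow> - a \<in> relation_ideal"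
  using relation_ideal_left[of a "- 1"] by simp

definition alg_rel :: "'k::field free_alg \<Rightarrow> 'k free_alg \<Rightarrow> bool"
  where "alg_rel p q \<longleftrightarrow> p - q \<in> relation_ideal"

lemma equivp_alg_rel: "equivp (alg_rel :: 'k::field free_alg \<Rightarrow> 'k free_alg \<Rightarrow> bool)"
proof (rule equivpI)
  show "reflp (alg_rel :: 'k free_alg \<Rightarrow> _)"
    by (simp add: reflp_def alg_rel_def relation_ideal_zero)
  show "symp (alg_rel :: 'k free_alg \<Rightarrow> _)"
  proof (rule sympI)
    fix p q :: "'k free_alg"
    assume "alg_rel p q"
    then show "alg_rel q p"
      using relation_ideal_minus[of "p - q"] by (simp add: alg_rel_def)
  qed
  show "transp (alg_rel :: 'k free_alg \<Rightarrow> _)"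
  proof (rule transpI)
    fix p q r :: "'k free_alg"
    assume "alg_rel p q" "alg_rel q r"
    then show "alg_rel p r"
      using relation_ideal_add[of "p - q" "q - r"] by (simp add: alg_rel_def)
  qed
qed

text \<open>The algebra \<open>K\<langle>x,y,z\<rangle> / (xy + yx - 2z, yz + zy - 2x, zx + xz - 2y)\<close>.\<close>

quotient_type (overloaded) 'k alg = "'k::field free_alg" / alg_rel
  by (rule equivp_alg_rel)

lemma lookup_mult_zero_word:
  fixes p q :: "'k::field free_alg"
  shows "Poly_Mapping.lookup (p * q) 0 = Poly_Mapping.lookup p 0 * Poly_Mapping.lookup q 0"
proof -
  have split: "u + v = (0 :: gen word) \<longleftrightarrow> v = 0 \<and> u = 0" for u v
    by (cases u; cases v) (auto simp: zero_word_def plus_word_def)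
  have inner: "(\<Sum>v. Poly_Mapping.lookup q v when u + v = 0) = (Poly_Mapping.lookup q 0 when u = 0)" for u
    by (cases "u = 0") (simp_all add: split)
  show ?thesis
    by (simp add: lookup_mult inner mult_when)
qed

lemma one_notin_relation_ideal: "(1 :: 'k::field free_alg) \<notin> relation_ideal"
proof -
  let ?J = "{p :: 'k free_alg. Poly_Mapping.lookup p 0 = 0}"
  have free_gen_lookup: "Poly_Mapping.lookup (free_gen g :: 'k free_alg) 0 = 0" for g
    by (simp add: free_gen_def lookup_single zero_word_def)
  have "two_sided_ideal ?J"
    by (auto simp: two_sided_ideal_def lookup_add lookup_mult_zero_word)
  moreover have "relators \<subseteq> ?J"
    by (auto simp: relators_def lookup_add lookup_minus lookup_mult_zero_word free_gen_lookup)
  ultimately have "relation_ideal \<subseteq> ?J"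
    unfolding relation_ideal_def ideal_generated_def by blast
  then show ?thesis
    by (auto simp: lookup_one)
qed

instantiation alg :: (field) ring_1
begin

lift_definition zero_alg :: "'a alg" is 0 .

lift_definition one_alg :: "'a alg" is 1 .

lift_definition plus_alg :: "'a alg \<Rightarrow> 'a alg \<Rightarrow> 'a alg" is "(+)"
proof -
  fix p p' q q' :: "'a free_alg"
  assume "alg_rel p p'" "alg_rel q q'"
  then show "alg_rel (p + q) (p' + q')"
    using relation_ideal_add[of "p - p'" "q - q'"] by (simp add: alg_rel_def algebra_simps)
qed

lift_definition uminus_alg :: "'a alg \<Rightarrow> 'a alg" is uminus
proof -
  fix p p' :: "'a free_alg"
  assume "alg_rel p p'"
  then show "alg_rel (- p) (- p')"
    using relation_ideal_minus[of "p - p'"] by (simp add: alg_rel_def algebra_simps)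
qed

lift_definition minus_alg :: "'a alg \<Rightarrow> 'a alg \<Rightarrow> 'a alg" is "(-)"
proof -
  fix p p' q q' :: "'a free_alg"
  assume "alg_rel p p'" "alg_rel q q'"
  then show "alg_rel (p - q) (p' - q')"
    using relation_ideal_add[OF _ relation_ideal_minus, of "p - p'" "q - q'"]
    by (simp add: alg_rel_def algebra_simps)
qed

lift_definition times_alg :: "'a alg \<Rightarrow> 'a alg \<Rightarrow> 'a alg" is "(*)"
proof -
  fix p p' q q' :: "'a free_alg"
  assume "alg_rel p p'" "alg_rel q q'"
  then show "alg_rel (p * q) (p' * q')"
    using relation_ideal_add[OF relation_ideal_right relation_ideal_left, of "p - p'" "q - q'" q p']
    by (simp add: alg_rel_def algebra_simps)
qed

instance
proof
  show "(0 :: 'a alg) \<noteq> 1"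
  proof transfer
    show "\<not> alg_rel (0 :: 'a free_alg) 1"
      using one_notin_relation_ideal relation_ideal_minus[of "- 1 :: 'a free_alg"]
      by (auto simp: alg_rel_def)
  qed
qed (transfer; simp add: alg_rel_def relation_ideal_zero algebra_simps)+

end

lift_definition alg_scale :: "'k::field \<Rightarrow> 'k alg \<Rightarrow> 'k alg" is free_scale
proof -
  fix c :: 'k and p p' :: "'k free_alg"
  assume "alg_rel p p'"
  then show "alg_rel (free_scale c p) (free_scale c p')"
    using relation_ideal_left[of "p - p'" "Poly_Mapping.single 0 c"]
    by (simp add: alg_rel_def free_scale_def algebra_simps)
qed

lift_definition X :: "'k::field alg" is "free_gen GX" .
lift_definition Y :: "'k::field alg" is "free_gen GY" .
lift_definition Z :: "'k::field alg" is "free_gen GZ" .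

lemma vector_space_alg_scale: "vector_space (alg_scale :: 'k::field \<Rightarrow> 'k alg \<Rightarrow> 'k alg)"
  by standard
     (transfer; simp add: alg_rel_def free_scale_def relation_ideal_zero algebra_simps
        single_add mult_single flip: mult.assoc)+

lemma free_scale_central:
  fixes p :: "'k::field free_alg"
  shows "p * Poly_Mapping.single 0 c = Poly_Mapping.single 0 c * p"
proof (induction p rule: update_induct)
  case const
  then show ?case by simp
next
  case (update p w b)
  have "Poly_Mapping.update w b p = p + Poly_Mapping.single w b"
    using update by (intro poly_mapping_eqI)
      (auto simp: lookup_update lookup_add lookup_single in_keys_iff when_def)
  then show ?case
    using update.IH by (simp add: algebra_simps mult_single)
qed

lemma alg_scale_mult:
  "alg_scale c (a * b) = alg_scale c a * b" "alg_scale c (a * b) = a * alg_scale c b"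
   by (transfer; simp add: alg_rel_def free_scale_def relation_ideal_zero free_scale_central
        flip: mult.assoc)+

lemma alg_relations: "X * Y + Y * X = 2 * Z" "Y * Z + Z * Y = 2 * X" "Z * X + X * Z = 2 * Y"
proof -
  have sub: "relators \<subseteq> relation_ideal"
    unfolding relation_ideal_def ideal_generated_def by blast
  have two: "2 * a = a + a" for a :: "'k::field alg"
    by (simp add: mult_2)
  have two': "2 * a = a + a" for a :: "'k::field free_alg"
    by (simp add: mult_2)
  show "X * Y + Y * X = 2 * Z" "Y * Z + Z * Y = 2 * X" "Z * X + X * Z = 2 * Y"
    unfolding two
    by (transfer; use sub in \<open>auto simp: relators_def alg_rel_def two'\<close>)+
qed

definition alg_automorphism :: "('k::field alg \<Rightarrow> 'k alg) \<Rightarrow> bool"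
  where "alg_automorphism \<sigma> \<longleftrightarrow>
    Vector_Spaces.linear alg_scale alg_scale \<sigma> \<and> (\<forall>a b. \<sigma> (a * b) = \<sigma> a * \<sigma> b) \<and> \<sigma> 1 = 1 \<and> bij \<sigma>"

definition Aut_alg :: "('k::field alg \<Rightarrow> 'k alg) monoid"
  where "Aut_alg = \<lparr>carrier = {\<sigma>. alg_automorphism \<sigma>}, monoid.mult = (\<circ>), one = id\<rparr>"

definition signed_gens :: "'k::field alg set"
  where "signed_gens = {X, - X, Y, - Y, Z, - Z}"

definition signed_gens_stabilizer :: "('k::field alg \<Rightarrow> 'k alg) set"
  where "signed_gens_stabilizer = {\<sigma> \<in> carrier Aut_alg. \<sigma> ` signed_gens = signed_gens}"

definition G_group :: "('k::field alg \<Rightarrow> 'k alg) monoid"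
  where "G_group = Aut_alg\<lparr>carrier := signed_gens_stabilizer\<rparr>"

lemma alg_automorphism_inv:
  assumes "alg_automorphism \<sigma>"
  shows "alg_automorphism (inv_into UNIV \<sigma>)"
proof -
  let ?\<tau> = "inv_into UNIV \<sigma>"
  have s: "\<sigma> (?\<tau> a) = a" and t: "?\<tau> (\<sigma> a) = a" for a
    using assms by (auto simp: alg_automorphism_def bij_def surj_f_inv_f)
  interpret \<sigma>: Vector_Spaces.linear alg_scale alg_scale \<sigma>
    using assms by (simp add: alg_automorphism_def)
  have "Vector_Spaces.linear alg_scale alg_scale ?\<tau>"
  proof
    show "?\<tau> (a + b) = ?\<tau> a + ?\<tau> b" for a b
      using t[of "?\<tau> a + ?\<tau> b"] by (simp add: \<sigma>.add s)
    show "?\<tau> (alg_scale c a) = alg_scale c (?\<tau> a)" for c a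
      using t[of "alg_scale c (?\<tau> a)"] by (simp add: \<sigma>.scale s)
  qed
  moreover have "?\<tau> (a * b) = ?\<tau> a * ?\<tau> b" for a b
    using t[of "?\<tau> a * ?\<tau> b"] assms by (simp add: s alg_automorphism_def)
  moreover have "?\<tau> 1 = 1"
    using t[of 1] assms by (simp add: alg_automorphism_def)
  moreover have "bij ?\<tau>"
    using assms by (simp add: alg_automorphism_def bij_imp_bij_inv)
  ultimately show ?thesis by (simp add: alg_automorphism_def)
qed

lemma alg_automorphism_comp:
  "alg_automorphism \<sigma> \<Longrightarrow> alg_automorphism \<tau> \<Longrightarrow> alg_automorphism (\<sigma> \<circ> \<tau>)"
  by (auto simp: alg_automorphism_def bij_comp intro: Vector_Spaces.linear_compose)

lemma alg_automorphism_id: "alg_automorphism id"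
  using vector_space.linear_id[OF vector_space_alg_scale] by (simp add: alg_automorphism_def)

lemma group_Aut_alg: "group Aut_alg"
proof (rule groupI)
  fix \<sigma> :: "'k::field alg \<Rightarrow> 'k alg"
  assume "\<sigma> \<in> carrier Aut_alg"
  then have "alg_automorphism \<sigma>" by (simp add: Aut_alg_def)
  then show "\<exists>\<tau>\<in>carrier Aut_alg. \<tau> \<otimes>\<^bsub>Aut_alg\<^esub> \<sigma> = \<one>\<^bsub>Aut_alg\<^esub>"
    by (intro bexI[of _ "inv_into UNIV \<sigma>"])
       (auto simp: Aut_alg_def alg_automorphism_inv, auto simp: alg_automorphism_def bij_def)
qed (auto simp: Aut_alg_def alg_automorphism_comp alg_automorphism_id)

lemma subgroup_signed_gens_stabilizer: "subgroup signed_gens_stabilizer Aut_alg"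
proof (rule group.subgroupI[OF group_Aut_alg])
  show "signed_gens_stabilizer \<noteq> {}"
    by (auto simp: signed_gens_stabilizer_def Aut_alg_def intro!: exI[of _ id] alg_automorphism_id)
  fix \<sigma> :: "'k::field alg \<Rightarrow> 'k alg"
  assume s: "\<sigma> \<in> signed_gens_stabilizer"
  then have aut: "alg_automorphism \<sigma>" and im: "\<sigma> ` signed_gens = signed_gens"
    by (simp_all add: signed_gens_stabilizer_def Aut_alg_def)
  then have "inj \<sigma>" by (simp add: alg_automorphism_def bij_def)
  have "inv\<^bsub>Aut_alg\<^esub> \<sigma> = inv_into UNIV \<sigma>"
    using aut \<open>inj \<sigma>\<close>
    by (intro group.inv_equality[OF group_Aut_alg]) (auto simp: Aut_alg_def alg_automorphism_inv)
  moreover have "inv_into UNIV \<sigma> ` signed_gens = signed_gens"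
    using image_inv_f_f[OF \<open>inj \<sigma>\<close>, of signed_gens] im by simp
  ultimately show "inv\<^bsub>Aut_alg\<^esub> \<sigma> \<in> signed_gens_stabilizer"
    using aut by (simp add: signed_gens_stabilizer_def Aut_alg_def alg_automorphism_inv)
next
  fix \<sigma> \<tau> :: "'k::field alg \<Rightarrow> 'k alg"
  assume "\<sigma> \<in> signed_gens_stabilizer" "\<tau> \<in> signed_gens_stabilizer"
  then show "\<sigma> \<otimes>\<^bsub>Aut_alg\<^esub> \<tau> \<in> signed_gens_stabilizer"
    by (simp add: signed_gens_stabilizer_def Aut_alg_def alg_automorphism_comp image_comp[symmetric] del: o_apply)
qed (auto simp: signed_gens_stabilizer_def)

lemma group_G_group: "group G_group"
  unfolding G_group_def
  by (rule subgroup.subgroup_is_group[OF subgroup_signed_gens_stabilizer group_Aut_alg])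

text \<open>The four formal symbols \<open>0, x, y, z\<close>, kept distinct from the algebra elements they are named after.\<close>

datatype idx = I0 | Ix | Iy | Iz

primrec h :: "idx \<Rightarrow> 'k::field alg"
  where
    "h I0 = X + Y + Z"
  | "h Ix = X - Y - Z"
  | "h Iy = - X + Y - Z"
  | "h Iz = - X - Y + Z"

end

theory Submission
  imports Defs
begin

text \<open>The four characters of the algebra send \<open>(X, Y, Z)\<close> to sign vectors of product \<open>1\<close>, and they
  take the value \<open>3\<close> at one \<open>h n\<close> and \<open>- 1\<close> at the other three, so the \<open>h n\<close> are distinct.
  The signed generators are exactly the half sums \<open>(h a + h b) / 2\<close> with \<open>a \<noteq> b\<close>, and for distinct
  \<open>a, b, c, d\<close> the half sums of \<open>(a, b)\<close>, \<open>(a, c)\<close>, \<open>(a, d)\<close> satisfy the defining relations; this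
  turns permutations into automorphisms. Conversely, an automorphism in \<open>G\<close> sends \<open>X\<close> and \<open>Y\<close>
  to half sums of some \<open>(a, b)\<close> and \<open>(a, c)\<close>, and the first relation determines the image of \<open>Z\<close>.\<close>

section \<open>The universal property\<close>

lemma free_alg_induct [case_names zero add_single]:
  fixes p :: "'k::field free_alg"
  assumes "P 0" and "\<And>p w b. P p \<Longrightarrow> P (p + Poly_Mapping.single w b)"
  shows "P p"
proof (induction p rule: update_induct)
  case const
  show ?case by (rule assms(1))
next
  case (update p w b)
  have "Poly_Mapping.update w b p = p + Poly_Mapping.single w b"
    using update by (intro poly_mapping_eqI)
      (auto simp: lookup_update lookup_add lookup_single in_keys_iff when_def)
  then show ?case
    using assms(2)[OF update.IH] by simp
qed

text \<open>A unital \<open>'k\<close>-algebra structure on \<open>'r\<close>, encoded as a ring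
  homomorphism into the centre. With \<open>id\<close> on \<open>'k\<close> it yields characters;
  with \<open>k\<close> sent to \<open>alg_scale k 1\<close> it yields endomorphisms of the
  algebra.\<close>

locale central_hom =
  fixes c :: "'k::field \<Rightarrow> 'r::ring_1"
  assumes add: "c (a + b) = c a + c b"
    and mult: "c (a * b) = c a * c b"
    and one: "c 1 = 1"
    and central: "c a * r = r * c a"
begin

definition free_eval :: "(gen \<Rightarrow> 'r) \<Rightarrow> 'k free_alg \<Rightarrow> 'r"
  where "free_eval f p =
    (\<Sum>w\<in>Poly_Mapping.keys p. c (Poly_Mapping.lookup p w) * prod_list (map f (letters w)))"

lemma zero: "c 0 = 0"
  using add[of 0 0] by simp

text \<open>Enlarging the index set adds only zero terms since \<open>c 0 = 0\<close>; the sums of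
  two elements can then share one finite set.\<close>

lemma free_eval_superset:
  assumes "finite S" "Poly_Mapping.keys p \<subseteq> S"
  shows "free_eval f p = (\<Sum>w\<in>S. c (Poly_Mapping.lookup p w) * prod_list (map f (letters w)))"
  unfolding free_eval_def
  using assms by (intro sum.mono_neutral_left) (auto simp: in_keys_iff zero)

lemma free_eval_add: "free_eval f (p + q) = free_eval f p + free_eval f q"
proof -
  let ?S = "Poly_Mapping.keys p \<union> Poly_Mapping.keys q"
  have "Poly_Mapping.keys (p + q) \<subseteq> ?S"
    by (rule Poly_Mapping.keys_add)
  then show ?thesis
    by (simp add: free_eval_superset[of ?S] lookup_add add distrib_right sum.distrib)
qed

lemma free_eval_zero: "free_eval f 0 = 0"
  by (simp add: free_eval_def)

lemma free_eval_diff: "free_eval f (p - q) = free_eval f p - free_eval f q"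
  using free_eval_add[of f "p - q" q] by (simp add: algebra_simps)

lemma free_eval_single:
  "free_eval f (Poly_Mapping.single w b) = c b * prod_list (map f (letters w))"
  by (subst free_eval_superset[of "{w}"]) auto

lemma free_eval_mult_single:
  "free_eval f (p * Poly_Mapping.single w b) =
    free_eval f p * free_eval f (Poly_Mapping.single w b)"
proof (induction p rule: free_alg_induct)
  case zero
  show ?case by (simp add: free_eval_zero)
next
  case (add_single p v a)
  \<comment> \<open>Centrality moves \<open>c b\<close> past the product over the letters of
    \<open>v\<close>.\<close>
  have "c (a * b) * (prod_list (map f (letters v)) * prod_list (map f (letters w))) =
      c a * prod_list (map f (letters v)) * (c b * prod_list (map f (letters w)))"
    by (metis mult central mult.assoc)
  then have "free_eval f (Poly_Mapping.single v a * Poly_Mapping.single w b) =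
      free_eval f (Poly_Mapping.single v a) * free_eval f (Poly_Mapping.single w b)"
    by (simp add: mult_single free_eval_single plus_word_def)
  then show ?case
    by (simp add: distrib_right free_eval_add add_single.IH)
qed

lemma free_eval_mult: "free_eval f (p * q) = free_eval f p * free_eval f q"
  by (induction q rule: free_alg_induct)
     (simp_all add: free_eval_zero distrib_left free_eval_add free_eval_mult_single)

lemma free_eval_one: "free_eval f 1 = 1"
proof -
  have "letters (0 :: gen word) = []"
    by (simp add: zero_word_def)
  then show ?thesis
    using free_eval_single[of f 0 1] by (simp add: one)
qed

lemma free_eval_free_gen: "free_eval f (free_gen g) = f g"
  by (simp add: free_gen_def free_eval_single one)

lemma free_eval_two: "free_eval f 2 = 2"
  using free_eval_add[of f 1 1] by (simp add: free_eval_one)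

text \<open>The kernel of \<open>free_eval f\<close> is a two-sided ideal, and the three equations
  put the relators into it.\<close>

lemma free_eval_relation_ideal:
  assumes "f GX * f GY + f GY * f GX = 2 * f GZ"
    and "f GY * f GZ + f GZ * f GY = 2 * f GX"
    and "f GZ * f GX + f GX * f GZ = 2 * f GY"
    and "p \<in> relation_ideal"
  shows "free_eval f p = 0"
proof -
  let ?J = "{p. free_eval f p = 0}"
  have "two_sided_ideal ?J"
    by (simp add: two_sided_ideal_def free_eval_zero free_eval_add free_eval_mult)
  moreover have "relators \<subseteq> ?J"
    using assms(1-3)
    by (simp add: relators_def free_eval_diff free_eval_add free_eval_mult free_eval_two
        free_eval_free_gen)
  ultimately show ?thesis
    using assms(4) by (auto simp: relation_ideal_def ideal_generated_def)
qed

lemma alg_universal: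
  assumes "x * y + y * x = 2 * z" "y * z + z * y = 2 * x" "z * x + x * z = 2 * y"
  obtains F :: "'k alg \<Rightarrow> 'r"
  where "\<And>a b. F (a + b) = F a + F b" "\<And>a b. F (a * b) = F a * F b" "F 1 = 1"
    "\<And>k a. F (alg_scale k a) = c k * F a" "F X = x" "F Y = y" "F Z = z"
proof -
  define f where "f = case_gen x y z"
  define F where "F a = free_eval f (rep_alg a)" for a
  \<comment> \<open>Independence of the chosen representative: two representatives differ by an
    element of the relation ideal, which evaluation kills.\<close>
  have F_abs: "F (abs_alg p) = free_eval f p" for p
  proof -
    have "alg_rel (rep_alg (abs_alg p)) p"
      using Quotient_alg Quotient_rep_abs equivp_alg_rel equivp_reflp by metis
    then have "free_eval f (rep_alg (abs_alg p) - p) = 0"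
      using assms by (intro free_eval_relation_ideal) (simp_all add: f_def alg_rel_def)
    then show ?thesis
      by (simp add: F_def free_eval_diff)
  qed
  have scale: "free_eval f (free_scale k p) = c k * free_eval f p" for k p
    by (simp add: free_scale_def free_eval_mult free_eval_single zero_word_def)
  show thesis
  proof (rule that[of F])
    fix a b :: "'k alg" and k :: 'k
    obtain p q where [simp]: "a = abs_alg p" "b = abs_alg q"
      by (metis Quotient_abs_rep[OF Quotient_alg])
    show "F (a + b) = F a + F b" "F (a * b) = F a * F b"
      by (simp_all add: plus_alg.abs_eq times_alg.abs_eq F_abs free_eval_add free_eval_mult)
    show "F (alg_scale k a) = c k * F a"
      by (simp add: alg_scale.abs_eq F_abs scale)
  qed (simp_all add: one_alg.abs_eq X_def Y_def Z_def F_abs free_eval_one free_eval_free_gen f_def)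
qed

end

section \<open>Induction on the quotient algebra and cancellation of the factor 2\<close>

lemma alg_induct [case_names X Y Z one add mult scale]:
  fixes a :: "'k::field alg"
  assumes gens: "P X" "P Y" "P Z" and one: "P 1"
    and add: "\<And>a b. P a \<Longrightarrow> P b \<Longrightarrow> P (a + b)"
    and mult: "\<And>a b. P a \<Longrightarrow> P b \<Longrightarrow> P (a * b)"
    and scale: "\<And>k a. P a \<Longrightarrow> P (alg_scale k a)"
  shows "P a"
proof -
  have gen: "P (abs_alg (free_gen g))" for g
    using gens by (cases g) (simp_all add: X_def Y_def Z_def)
  \<comment> \<open>Words are products of generators, the empty word being \<open>1\<close>; scalars
    and sums then reach every element.\<close>
  have word: "P (abs_alg (Poly_Mapping.single (Word l) 1))" for l
  proof (induction l)
    case Nil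
    show ?case using one by (simp add: one_alg.abs_eq flip: zero_word_def)
  next
    case (Cons g l)
    have "Poly_Mapping.single (Word (g # l)) (1::'k) =
        free_gen g * Poly_Mapping.single (Word l) 1"
      by (simp add: free_gen_def mult_single plus_word_def)
    then show ?case
      using mult[OF gen[of g] Cons.IH] by (simp add: times_alg.abs_eq)
  qed
  have single: "P (abs_alg (Poly_Mapping.single w b))" for w b
  proof -
    have "Poly_Mapping.single w b = free_scale b (Poly_Mapping.single w 1)"
      by (simp add: free_scale_def mult_single)
    then show ?thesis
      using scale[OF word[of "letters w"], of b] by (simp add: alg_scale.abs_eq)
  qed
  have "P (abs_alg p)" for p
  proof (induction p rule: free_alg_induct)
    case zero
    show ?case using single[of 0 0] by simp
  next
    case (add_single p w b)
    show ?case using add[OF add_single single[of w b]] by (simp add: plus_alg.abs_eq)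
  qed
  then show ?thesis
    by (metis Quotient_abs_rep[OF Quotient_alg])
qed

text \<open>In characteristic zero 2 is invertible, and scaling by \<open>1/2\<close> undoes the
  doubling.\<close>

lemma alg_double_cancel:
  fixes a b :: "'k::field_char_0 alg"
  assumes "a + a = b + b"
  shows "a = b"
proof -
  interpret vector_space "alg_scale :: 'k \<Rightarrow> 'k alg \<Rightarrow> 'k alg"
    by (rule vector_space_alg_scale)
  have "alg_scale (1/2) (u + u) = u" for u :: "'k alg"
    by (simp add: scale_right_distrib flip: scale_left_distrib)
  then show ?thesis
    using assms by metis
qed

section \<open>The elements \<open>h n\<close>\<close>

lemma inj_h: "inj (h :: idx \<Rightarrow> 'k::field_char_0 alg)"
proof (rule injI, rule ccontr)
  fix m n
  assume eq: "(h m :: 'k alg) = h n" and "m \<noteq> n"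
  interpret central_hom "id :: 'k \<Rightarrow> 'k"
    by standard simp_all
  \<comment> \<open>The signs are the coefficients of \<open>X\<close> and \<open>Y\<close> in
    \<open>h m\<close>; that of \<open>Z\<close> is their product. The relations hold because signs
    square to 1, and \<open>h m\<close> is sent to a sum of three squares.\<close>
  define x y :: 'k where "x = (if m \<in> {I0, Ix} then 1 else - 1)"
    and "y = (if m \<in> {I0, Iy} then 1 else - 1)"
  have "x * y + y * x = 2 * (x * y)" "y * (x * y) + x * y * y = 2 * x"
    "x * y * x + x * (x * y) = 2 * y"
    by (simp_all add: x_def y_def)
  from alg_universal[OF this] obtain F :: "'k alg \<Rightarrow> 'k"
    where F: "\<And>a b. F (a + b) = F a + F b" "F X = x" "F Y = y" "F Z = x * y"
    by metis
  have diff: "F (a - b) = F a - F b" for a b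
    using F(1)[of "a - b" b] by simp
  have minus: "F (- a) = - F a" for a
    using diff[of 0 a] diff[of 0 0] by simp
  have "F (h i) = (if i = m then 3 else - 1)" for i
    by (cases i; cases m) (simp_all add: F diff minus x_def y_def)
  with eq \<open>m \<noteq> n\<close> show False
    by (metis (full_types) numeral_neq_neg_one)
qed

section \<open>Half sums of pairs of the \<open>h n\<close>\<close>

lemma h_double: "h I0 + h Ix = X + X" "h I0 + h Iy = Y + Y" "h I0 + h Iz = Z + Z"
  by simp_all

text \<open>Off the diagonal this is half of \<open>h a + h b\<close>, tabulated as a signed
  generator so that no division enters. The diagonal value 0 only makes the function total.\<close>

fun half_sum :: "idx \<Rightarrow> idx \<Rightarrow> 'k::field alg"
  where
    "half_sum I0 Ix = X" | "half_sum Ix I0 = X" | "half_sum Iy Iz = - X" | "half_sum Iz Iy = - X"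
  | "half_sum I0 Iy = Y" | "half_sum Iy I0 = Y" | "half_sum Ix Iz = - Y" | "half_sum Iz Ix = - Y"
  | "half_sum I0 Iz = Z" | "half_sum Iz I0 = Z" | "half_sum Ix Iy = - Z" | "half_sum Iy Ix = - Z"
  | "half_sum _ _ = 0"

text \<open>For fixed \<open>a\<close> the three half sums are \<open>X\<close>, \<open>Y\<close>,
  \<open>Z\<close> in some order, with either no sign or two signs changed. Each case is a defining
  relation, up to swapping the summands and a common sign.\<close>

lemma half_sum_relation:
  assumes "distinct [a, b, c, d]"
  shows "half_sum a b * half_sum a c + half_sum a c * half_sum a b =
    (2 :: 'k::field alg) * half_sum a d"
proof -
  have swap: "v * u + u * v = w" and neg: "- (u * v) - v * u = - w"
    if "u * v + v * u = w" for u v w :: "'k alg"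
    using that by (simp_all add: algebra_simps)
  note rels = alg_relations alg_relations[THEN swap]
  show ?thesis
    using assms by (cases a; cases b; cases c; cases d) (simp_all add: rels rels[THEN neg])
qed

text \<open>The sign pattern is that of \<open>h\<close> itself. Hence an additive map sending
  \<open>X\<close>, \<open>Y\<close>, \<open>Z\<close> to these half sums sends \<open>h I0\<close>,
  \<open>h Ix\<close>, \<open>h Iy\<close>, \<open>h Iz\<close> to \<open>h a\<close>,
  \<open>h b\<close>, \<open>h c\<close>, \<open>h d\<close>.\<close>

lemma h_half_sum:
  assumes "distinct [a, b, c, d]"
  shows "half_sum a b + half_sum a c + half_sum a d = h a"
    and "half_sum a b - half_sum a c - half_sum a d = h b"
    and "- half_sum a b + half_sum a c - half_sum a d = h c"
    and "- half_sum a b - half_sum a c + half_sum a d = h d"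
  using assms by (cases a; cases b; cases c; cases d; simp)+

lemma ex_idx: "(\<exists>i. P i) \<longleftrightarrow> P I0 \<or> P Ix \<or> P Iy \<or> P Iz"
  by (metis idx.exhaust)

text \<open>Signed generators label the edges of a tetrahedron with vertices \<open>idx\<close>,
  opposite edges carrying opposite elements. Two edges that are neither equal nor opposite meet in
  one vertex, \<open>a\<close>.\<close>

lemma signed_gens_half_sums:
  assumes "u \<in> signed_gens" "v \<in> signed_gens" "u \<noteq> v" "u \<noteq> - v"
  obtains a b c d where "distinct [a, b, c, d]" "u = half_sum a b" "v = half_sum a c"
proof -
  have "\<exists>a b c d. distinct [a, b, c, d] \<and> u = half_sum a b \<and> v = half_sum a c"
    using assms unfolding signed_gens_def
    by (elim insertE emptyE) (simp_all add: ex_idx)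
  with that show thesis by blast
qed

section \<open>Automorphisms and permutations\<close>

lemma alg_automorphismD:
  assumes "alg_automorphism \<sigma>"
  shows "\<sigma> (a + b) = \<sigma> a + \<sigma> b" "\<sigma> (a - b) = \<sigma> a - \<sigma> b" "\<sigma> (- a) = - \<sigma> a"
    "\<sigma> (a * b) = \<sigma> a * \<sigma> b" "\<sigma> 1 = 1" "\<sigma> (alg_scale k a) = alg_scale k (\<sigma> a)" "inj \<sigma>"
proof -
  interpret Vector_Spaces.linear alg_scale alg_scale \<sigma>
    using assms by (simp add: alg_automorphism_def)
  show "\<sigma> (a + b) = \<sigma> a + \<sigma> b" "\<sigma> (a - b) = \<sigma> a - \<sigma> b" "\<sigma> (- a) = - \<sigma> a"
    "\<sigma> (alg_scale k a) = alg_scale k (\<sigma> a)"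
    by (simp_all add: add diff neg scale)
  show "\<sigma> (a * b) = \<sigma> a * \<sigma> b" "\<sigma> 1 = 1" "inj \<sigma>"
    using assms by (simp_all add: alg_automorphism_def bij_def)
qed

lemma G_group_carrier:
  "\<sigma> \<in> carrier G_group \<longleftrightarrow> alg_automorphism \<sigma> \<and> \<sigma> ` signed_gens = signed_gens"
  by (simp add: G_group_def signed_gens_stabilizer_def Aut_alg_def)

lemma stabilizer_permutes_h:
  fixes \<sigma> :: "'k::field_char_0 alg \<Rightarrow> 'k alg"
  assumes "\<sigma> \<in> carrier G_group"
  shows "\<sigma> (h n) \<in> range h"
proof -
  have aut: "alg_automorphism \<sigma>" and im: "\<sigma> ` signed_gens = signed_gens"
    using assms by (simp_all add: G_group_carrier)
  note \<sigma> = alg_automorphismD[OF aut]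
  have inj: "inj (h :: idx \<Rightarrow> 'k alg)"
    by (rule inj_h)
  \<comment> \<open>Distinctness passes from the \<open>h n\<close> to the generators:
    \<open>X = Y\<close> would make both \<open>h Ix\<close> and \<open>h Iy\<close> equal to
    \<open>- Z\<close>.\<close>
  have "X \<noteq> (Y :: 'k alg)"
    using injD[OF inj, of Ix Iy] by auto
  moreover have "X \<noteq> - (Y :: 'k alg)"
  proof
    assume "X = - (Y :: 'k alg)"
    moreover have "h I0 - h Iz = (X + Y) + (X + Y :: 'k alg)" by simp
    ultimately have "h I0 = (h Iz :: 'k alg)"
      by (metis add_0 eq_iff_diff_eq_0 eq_neg_iff_add_eq_0)
    then show False using injD[OF inj, of I0 Iz] by simp
  qed
  ultimately have "\<sigma> X \<noteq> \<sigma> Y" "\<sigma> X \<noteq> - \<sigma> Y"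
    using inj_eq[OF \<sigma>(7), of X] by (simp_all flip: \<sigma>(3))
  moreover have "\<sigma> X \<in> signed_gens" "\<sigma> Y \<in> signed_gens"
    by (metis im imageI insertI1 insertI2 signed_gens_def)+
  ultimately obtain a b c d where dist: "distinct [a, b, c, d]"
    and XY: "\<sigma> X = half_sum a b" "\<sigma> Y = half_sum a c"
    by (metis signed_gens_half_sums)
  have "\<sigma> Z + \<sigma> Z = \<sigma> (X * Y + Y * X)"
    by (simp only: alg_relations mult_2 \<sigma>)
  also have "\<dots> = half_sum a d + half_sum a d"
    by (simp only: \<sigma> XY half_sum_relation[OF dist] mult_2)
  finally have Z: "\<sigma> Z = half_sum a d"
    by (rule alg_double_cancel)
  have "\<sigma> (h I0) = h a" "\<sigma> (h Ix) = h b" "\<sigma> (h Iy) = h c" "\<sigma> (h Iz) = h d"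
    using h_half_sum[OF dist] by (simp_all add: \<sigma> XY Z)
  then show ?thesis
    by (cases n) auto
qed

section \<open>Homomorphisms determined by their values on the \<open>h n\<close>, and the
  realization of permutations\<close>

lemma alg_hom_eqI:
  fixes F F' :: "'k::field_char_0 alg \<Rightarrow> 'k alg"
  assumes "\<And>a b. F (a + b) = F a + F b" "\<And>a b. F (a * b) = F a * F b" "F 1 = 1"
    "\<And>k a. F (alg_scale k a) = alg_scale k (F a)"
    and "\<And>a b. F' (a + b) = F' a + F' b" "\<And>a b. F' (a * b) = F' a * F' b" "F' 1 = 1"
    "\<And>k a. F' (alg_scale k a) = alg_scale k (F' a)"
    and h: "\<And>n. F (h n) = F' (h n)"
  shows "F = F'"
proof
  \<comment> \<open>Each generator is half of some \<open>h I0 + h n\<close>, so agreement on the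
    \<open>h n\<close> forces agreement on generators.\<close>
  have "F u = F' u" if "h I0 + h n = u + u" for n u
    by (rule alg_double_cancel) (metis assms(1,5) h that)
  then have gens: "F X = F' X" "F Y = F' Y" "F Z = F' Z"
    using h_double by blast+
  show "F a = F' a" for a
    by (induction a rule: alg_induct) (simp_all add: assms(1-8) gens)
qed

lemma permutation_hom:
  fixes \<pi> :: "idx \<Rightarrow> idx"
  assumes "bij \<pi>"
  obtains F :: "'k::field alg \<Rightarrow> 'k alg"
  where "\<And>a b. F (a + b) = F a + F b" "\<And>a b. F (a * b) = F a * F b" "F 1 = 1"
    "\<And>k a. F (alg_scale k a) = alg_scale k (F a)" "\<And>n. F (h n) = h (\<pi> n)"
    "F ` signed_gens \<subseteq> signed_gens"
proof -
  interpret V: vector_space "alg_scale :: 'k \<Rightarrow> 'k alg \<Rightarrow> 'k alg"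
    by (rule vector_space_alg_scale)
  interpret central_hom "\<lambda>k :: 'k. alg_scale k (1 :: 'k alg)"
  proof
    fix a b :: 'k and r :: "'k alg"
    show "alg_scale (a + b) 1 = alg_scale a 1 + alg_scale b (1 :: 'k alg)"
      by (rule V.scale_left_distrib)
    show "alg_scale (a * b) 1 = alg_scale a 1 * alg_scale b (1 :: 'k alg)"
      by (simp flip: alg_scale_mult(1))
    show "alg_scale a 1 * r = r * alg_scale a 1"
      by (simp flip: alg_scale_mult)
  qed simp
  define a b c d where abcd: "a = \<pi> I0" "b = \<pi> Ix" "c = \<pi> Iy" "d = \<pi> Iz"
  have dist: "distinct [a, b, c, d]"
    using assms by (auto simp: abcd bij_def dest: injD)
  \<comment> \<open>Rotating \<open>b\<close>, \<open>c\<close>, \<open>d\<close> cyclically turns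
    the first relation into the other two.\<close>
  then have "distinct [a, c, d, b]" "distinct [a, d, b, c]"
    by auto
  from alg_universal[OF half_sum_relation[OF dist] this[THEN half_sum_relation]]
  obtain F :: "'k alg \<Rightarrow> 'k alg" where F: "\<And>a b. F (a + b) = F a + F b"
    "\<And>a b. F (a * b) = F a * F b" "F 1 = 1" "\<And>k u. F (alg_scale k u) = alg_scale k 1 * F u"
    and gens: "F X = half_sum a b" "F Y = half_sum a c" "F Z = half_sum a d"
    by blast
  have diff: "F (u - v) = F u - F v" for u v
    using F(1)[of "u - v" v] by (simp add: algebra_simps)
  have minus: "F (- u) = - F u" for u
    using diff[of 0 u] F(1)[of 0 0] by simp
  show thesis
  proof (rule that[of F])
    show "F (alg_scale k u) = alg_scale k (F u)" for k u
      by (simp add: F(4) flip: alg_scale_mult(1))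
    have "F (h I0) = h a" "F (h Ix) = h b" "F (h Iy) = h c" "F (h Iz) = h d"
      using h_half_sum[OF dist] by (simp_all add: F(1) diff minus gens)
    then show "F (h n) = h (\<pi> n)" for n
      by (cases n) (simp_all add: abcd)
    have "half_sum i j \<in> (signed_gens :: 'k alg set)" "- half_sum i j \<in> (signed_gens :: 'k alg set)"
      if "i \<noteq> j" for i j
      using that by (cases i; cases j; simp add: signed_gens_def)+
    moreover have "F ` signed_gens = {half_sum a b, - half_sum a b, half_sum a c,
        - half_sum a c, half_sum a d, - half_sum a d}"
      by (simp add: signed_gens_def minus gens)
    ultimately show "F ` signed_gens \<subseteq> signed_gens"
      using dist by simp
  qed (fact F)+
qed

lemma permutation_automorphism:
  fixes \<pi> :: "idx \<Rightarrow> idx"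
  assumes "bij \<pi>"
  obtains \<sigma> :: "'k::field_char_0 alg \<Rightarrow> 'k alg"
  where "\<sigma> \<in> carrier G_group" "\<And>n. \<sigma> (h n) = h (\<pi> n)"
proof -
  obtain F :: "'k alg \<Rightarrow> 'k alg" where F: "\<And>a b. F (a + b) = F a + F b"
    "\<And>a b. F (a * b) = F a * F b" "F 1 = 1" "\<And>k a. F (alg_scale k a) = alg_scale k (F a)"
    "\<And>n. F (h n) = h (\<pi> n)" "F ` signed_gens \<subseteq> signed_gens"
    using permutation_hom[OF assms] by blast
  obtain F' :: "'k alg \<Rightarrow> 'k alg" where F': "\<And>a b. F' (a + b) = F' a + F' b"
    "\<And>a b. F' (a * b) = F' a * F' b" "F' 1 = 1" "\<And>k a. F' (alg_scale k a) = alg_scale k (F' a)"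
    "\<And>n. F' (h n) = h (inv_into UNIV \<pi> n)" "F' ` signed_gens \<subseteq> signed_gens"
    using permutation_hom[OF bij_imp_bij_inv[OF assms]] by blast
  \<comment> \<open>Both composites fix every \<open>h n\<close>, hence are the identity.\<close>
  have "F \<circ> F' = id"
    by (rule alg_hom_eqI) (simp_all add: F(1-5) F'(1-5) bij_is_surj[OF assms] surj_f_inv_f)
  moreover have "F' \<circ> F = id"
    by (rule alg_hom_eqI) (simp_all add: F(1-5) F'(1-5) bij_is_inj[OF assms])
  ultimately have FF': "F \<circ> F' = id" "bij F"
    using o_bij by auto
  interpret V: vector_space "alg_scale :: 'k \<Rightarrow> 'k alg \<Rightarrow> 'k alg"
    by (rule vector_space_alg_scale)
  have "Vector_Spaces.linear alg_scale alg_scale F"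
    by standard (simp_all add: F)
  then have "alg_automorphism F"
    by (simp add: alg_automorphism_def F FF')
  \<comment> \<open>The inverse \<open>F'\<close> also preserves the signed generators, so
    \<open>F' u\<close> is a preimage of \<open>u\<close> among them.\<close>
  moreover have "signed_gens \<subseteq> F ` signed_gens"
  proof
    fix u :: "'k alg"
    assume "u \<in> signed_gens"
    then show "u \<in> F ` signed_gens"
      using F'(6) pointfree_idE[OF FF'(1), of u] by (metis image_eqI image_subset_iff)
  qed
  ultimately have "F \<in> carrier G_group"
    using F(6) by (simp add: G_group_carrier subset_antisym)
  then show thesis
    using F(5) that by blast
qed

theorem proposition2p13:
  shows "\<exists>\<phi> \<in> iso (G_group :: ('k::{alg_closed_field, field_char_0} alg \<Rightarrow> 'k alg) monoid)
                    (BijGroup (UNIV :: idx set)).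
           \<forall>\<sigma> \<in> carrier G_group. \<forall>n. \<sigma> (h n) = h (\<phi> \<sigma> n)"
proof -
  let ?G = "G_group :: ('k alg \<Rightarrow> 'k alg) monoid"
  define \<phi> :: "('k alg \<Rightarrow> 'k alg) \<Rightarrow> idx \<Rightarrow> idx" where "\<phi> \<sigma> n = inv_into UNIV h (\<sigma> (h n))" for \<sigma> n
  have \<phi>: "\<sigma> (h n) = h (\<phi> \<sigma> n)" if "\<sigma> \<in> carrier ?G" for \<sigma> n
    unfolding \<phi>_def using stabilizer_permutes_h[OF that] by (simp add: f_inv_into_f)
  have \<phi>_eqI: "\<phi> \<sigma> = \<pi>" if "\<And>n. \<sigma> (h n) = h (\<pi> n)" for \<sigma> \<pi>
    using that by (simp add: \<phi>_def fun_eq_iff inv_f_f[OF inj_h])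
  have fin: "finite (UNIV :: idx set)"
    by (rule finite_subset[of _ "{I0, Ix, Iy, Iz}"]) (use idx.exhaust in auto)
  have bij: "bij (\<phi> \<sigma>)" if "\<sigma> \<in> carrier ?G" for \<sigma>
  proof -
    have "inj \<sigma>"
      using that by (intro alg_automorphismD(7)) (simp add: G_group_carrier)
    then have "inj (\<phi> \<sigma>)"
      by (intro injI) (metis \<phi>[OF that] inj_h injD)
    then show ?thesis
      using fin by (simp add: bij_def finite_UNIV_inj_surj)
  qed
  have carrier: "carrier (BijGroup (UNIV :: idx set)) = {\<pi>. bij \<pi>}"
    by (simp add: BijGroup_def Bij_def)
  have "\<phi> \<in> hom ?G (BijGroup UNIV)"
  proof (rule homI)
    fix \<sigma> \<tau>
    assume \<sigma>: "\<sigma> \<in> carrier ?G" and \<tau>: "\<tau> \<in> carrier ?G"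
    have "\<phi> (\<sigma> \<circ> \<tau>) = \<phi> \<sigma> \<circ> \<phi> \<tau>"
      by (rule \<phi>_eqI) (simp add: \<phi>[OF \<sigma>] \<phi>[OF \<tau>])
    then show "\<phi> (\<sigma> \<otimes>\<^bsub>?G\<^esub> \<tau>) = \<phi> \<sigma> \<otimes>\<^bsub>BijGroup UNIV\<^esub> \<phi> \<tau>"
      using bij[OF \<sigma>] bij[OF \<tau>]
      by (simp add: G_group_def Aut_alg_def BijGroup_def Bij_def compose_def comp_def restrict_UNIV)
  qed (simp add: carrier bij)
  moreover have "inj_on \<phi> (carrier ?G)"
  proof (rule inj_onI)
    fix \<sigma> \<tau>
    assume \<sigma>: "\<sigma> \<in> carrier ?G" and \<tau>: "\<tau> \<in> carrier ?G" and eq: "\<phi> \<sigma> = \<phi> \<tau>"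
    then have aut: "alg_automorphism \<sigma>" "alg_automorphism \<tau>"
      by (simp_all add: G_group_carrier)
    show "\<sigma> = \<tau>"
      by (rule alg_hom_eqI) (simp_all add: aut[THEN alg_automorphismD(1)]
          aut[THEN alg_automorphismD(4)] aut[THEN alg_automorphismD(5)]
          aut[THEN alg_automorphismD(6)] \<phi>[OF \<sigma>] \<phi>[OF \<tau>] eq)
  qed
  moreover have "\<phi> ` carrier ?G = {\<pi>. bij \<pi>}"
  proof
    show "{\<pi>. bij \<pi>} \<subseteq> \<phi> ` carrier ?G"
    proof
      fix \<pi> :: "idx \<Rightarrow> idx"
      assume "\<pi> \<in> {\<pi>. bij \<pi>}"
      then obtain \<sigma> where "\<sigma> \<in> carrier ?G" "\<And>n. \<sigma> (h n) = h (\<pi> n)"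
        using permutation_automorphism by blast
      then show "\<pi> \<in> \<phi> ` carrier ?G"
        using \<phi>_eqI[of \<sigma> \<pi>] by blast
    qed
  qed (auto simp: bij)
  ultimately have "\<phi> \<in> iso ?G (BijGroup UNIV)"
    by (simp add: iso_def bij_betw_def carrier)
  then show ?thesis
    using \<phi> by blast
qed

end
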